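(* Let $N>K\ge 2$ and let $X=(x_1,\dots,x_K)$ be a real $N\times K$ matrix of rank $K$ with first column $x_1=e=(1,\dots,1)'$. For $k\ge2$ let $\bar x_k$, $s_{xk}$, $\bar v_k$, $q_k^2$, $\theta_k$, $I_k$, $C_k=VIF_k$, $H_k$ be as in the context, and let $M_e=e(e'e)^{-1}e'$. (1) When $K\ge 3$, the inefficiency index $I_k$ is measured independently of the collinearity index $C_k=VIF_k$, and $I_k=1+\bar v_k^2$ is expressed as $$1+\bar v_k^2=1+\frac{\bar x_k^2}{s_{xk}^2}=1+\frac{x_k'M_ex_k}{x_k'(I-M_e)x_k}=1+\frac{q_k^2}{1-q_k^2}=\frac{1}{1-q_k^2},$$ which takes values on $[1,\infty)$ and is increasing in $q_k^2\in[0,1)$, where $q_k^2=(x_k'e)^2/[x_k'x_k\cdot e'e]=\cos^2(\theta_k)$ is the squared raw correlation of $x_1=e$ and $x_k$. (2) If $K=2$, then $I_2=1/(1-q_2^2)$ and $C_2=1/(1-q_2^2)$, and hence the two indexes are both a function of $q_2^2$, and $H_2=1/(1-q_2^2)^2$ holds. Therefore the two indexes are not separable, and $H_2=1$ if and only if $x_2'e=0$. (3) For $K\ge 2$, $I_k=1/(1-q_k^2)$ is a collinearity measure between $x_1=e$ and $x_k$, which is also a measure of immobility of $x_k=\{x_{nk}\}$ over $n=1,\dots,N$.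
   Context: Notation: a prime denotes transpose, $I$ without subscript is the $N\times N$ identity matrix, and $x_k=(x_{1k},\dots,x_{Nk})'$. For $k\ge 2$, $\bar x_k=\frac1N\sum_{n=1}^N x_{nk}$, $s_{xk}^2=\frac1N\sum_{n=1}^N (x_{nk}-\bar x_k)^2$ (positive, by the rank assumption), $v_{nk}=x_{nk}/s_{xk}$, and $\bar v_k=\frac1N\sum_{n=1}^N v_{nk}$; here $\bar x_k^2=(\bar x_k)^2$ and $\bar v_k^2=(\bar v_k)^2$. $\theta_k$ is the angle between the vectors $x_k$ and $e$. The setting is the linear regression model $y=X\beta+u$ with $E(u)=0$, $Var(u)=\sigma^2 I$, and ordinary least squares estimator $\hat\beta=(X'X)^{-1}X'y$. The average over $n$ of the variances $Var(x_{nk}\hat\beta_k)$ equals $\sigma^2 H_k/N$ with $H_k=I_kC_k$. The inefficiency index is $I_k=\frac{\sum_{n=1}^N x_{nk}^2}{N s_{xk}^2}=1+\bar v_k^2$; it depends only on the column $x_k$ itself. The collinearity index is $C_k=VIF_k=1/(1-\check R_k^2)$ (the variance inflation factor), where $\check R_k^2$ is the coefficient of determination in the least squares regression of $x_k$ on all other columns of $X$ (including $e$). In the special case $K=2$, where the only other column is $e$, the coefficient of determination of $x_2$ regressed on $e$ is taken to be the normalized squared inner product $\check R_2^2=(x_2'e)^2/[(x_2'x_2)(e'e)]$. Meaning of the descriptive terms: "measured independently" in (1) is used in the sense that the two effects $I_k$ and $C_k$ are functionally independent (so that they can be controlled separately) when $K\ge3$; "not separable" in (2) is the contrasting situation in which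 both indexes are functions of the same quantity $q_2^2$, so that they can only be controlled simultaneously. "Immobility" in (3) refers to how nearly constant the entries $x_{nk}$ are over $n$: the closer $q_k^2$ is to 1 (equivalently, the larger $I_k$ is), the closer $x_k$ is to a constant multiple of $e$. *)

theory Defs
  imports "HOL-Analysis.Analysis"
begin

text \<open>
  An \<open>N \<times> K\<close> design matrix has type \<^typ>\<open>real^'k^'n\<close> with \<open>N = CARD('n)\<close> and \<open>K = CARD('k)\<close>;
  its \<open>k\<close>-th column is \<open>column k X\<close>. A finite index type carries no first element, so the
  position of the column \<open>e\<close> is an explicit index \<open>k1\<close>.
\<close>

definition ones :: "real^'n" where
  "ones = (\<chi> n. 1)"

definition design_matrices :: "'k::finite \<Rightarrow> (real^'k^'n) set" where
  "design_matrices k1 = {X. rank X = CARD('k) \<and> column k1 X = ones}"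

definition mean :: "real^'n \<Rightarrow> real" where
  "mean x = (\<Sum>n\<in>UNIV. x $ n) / real CARD('n)"

definition variance :: "real^'n \<Rightarrow> real" where
  "variance x = (\<Sum>n\<in>UNIV. (x $ n - mean x)\<^sup>2) / real CARD('n)"

definition std_dev :: "real^'n \<Rightarrow> real" where
  "std_dev x = sqrt (variance x)"

definition scaled :: "real^'n \<Rightarrow> real^'n" where
  "scaled x = (\<chi> n. x $ n / std_dev x)"

definition inefficiency :: "real^'n \<Rightarrow> real" where
  "inefficiency x = (\<Sum>n\<in>UNIV. (x $ n)\<^sup>2) / (real CARD('n) * variance x)"

text \<open>The projection matrix \<open>M\<^sub>e = e (e'e)\<^sup>-\<^sup>1 e'\<close>; the quadratic form \<open>x' M\<^sub>e x\<close> is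
  \<open>x \<bullet> (M_ones *v x)\<close>.\<close>

definition M_ones :: "real^'n^'n" where
  "M_ones = (\<chi> i j. ones $ i * inverse ((ones :: real^'n) \<bullet> ones) * ones $ j)"

text \<open>The squared raw (uncentred) correlation of \<open>e\<close> and \<open>x\<close>.\<close>

definition q2 :: "real^'n \<Rightarrow> real" where
  "q2 x = (x \<bullet> ones)\<^sup>2 / ((x \<bullet> x) * (ones \<bullet> (ones :: real^'n)))"

definition vec_angle :: "real^'n \<Rightarrow> real^'n \<Rightarrow> real" where
  "vec_angle x y = arccos ((x \<bullet> y) / (norm x * norm y))"

text \<open>The vector of least squares fitted values of \<open>y\<close> on a set \<open>S\<close> of regressors is the point
  of \<open>span S\<close> nearest to \<open>y\<close>. The coefficient of determination is the usual centred one,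
  \<open>1 - RSS/TSS\<close>, appropriate for regressions with an intercept.\<close>

definition ols_fit :: "(real^'n) set \<Rightarrow> real^'n \<Rightarrow> real^'n" where
  "ols_fit S y = closest_point (span S) y"

definition r_squared :: "(real^'n) set \<Rightarrow> real^'n \<Rightarrow> real" where
  "r_squared S y =
     1 - (\<Sum>n\<in>UNIV. (y $ n - ols_fit S y $ n)\<^sup>2) / (\<Sum>n\<in>UNIV. (y $ n - mean y)\<^sup>2)"

text \<open>For \<open>K = 2\<close> the only other column is \<open>e\<close>, the centred coefficient would vanish
  identically, and the normalized squared inner product is used instead.\<close>

definition R2_check :: "real^'k^'n \<Rightarrow> 'k \<Rightarrow> real" where
  "R2_check X k =
     (if CARD('k) = 2
      then (column k X \<bullet> ones)\<^sup>2 / ((column k X \<bullet> column k X) * (ones \<bullet> (ones :: real^'n)))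
      else r_squared {column j X | j. j \<noteq> k} (column k X))"

definition VIF :: "real^'k^'n \<Rightarrow> 'k \<Rightarrow> real" where
  "VIF X k = 1 / (1 - R2_check X k)"

definition H_index :: "real^'k^'n \<Rightarrow> 'k \<Rightarrow> real" where
  "H_index X k = inefficiency (column k X) * VIF X k"

text \<open>Two indexes on \<open>S\<close> are separable (functionally independent) if every value of one can be
  combined with every value of the other.\<close>

definition separable_on :: "'a set \<Rightarrow> ('a \<Rightarrow> real) \<Rightarrow> ('a \<Rightarrow> real) \<Rightarrow> bool" where
  "separable_on S F G \<longleftrightarrow> (\<lambda>X. (F X, G X)) ` S = F ` S \<times> G ` S"

text \<open>Scale-free distance of \<open>x\<close> from the constant vectors (multiples of \<open>e\<close>);
  the smaller it is, the more immobile is \<open>x\<close>.\<close>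

definition mobility :: "real^'n \<Rightarrow> real" where
  "mobility x = infdist x (range (\<lambda>c. c *\<^sub>R ones)) / norm x"

end

theory Submission
  imports Defs
begin

text \<open>
  Since \<open>\<Sum> x\<^sub>n\<^sup>2 = N (s\<^sub>x\<^sup>2 + mean\<^sup>2)\<close>, all quantities attached to a column are functions of the
  inefficiency index: \<open>q\<^sup>2 = cos\<^sup>2 \<theta> = 1 - 1/I\<close> and mobility\<open>\<^sup>2 = 1/I\<close>.
  For the separability, take an orthonormal family \<open>b\<close> with \<open>b k1\<close> proportional to \<open>e\<close>, keep
  \<open>b j\<close> as the remaining columns and let column \<open>k\<close> be \<open>\<alpha> e + b k + \<gamma> b k2\<close>. The parameter
  \<open>\<gamma>\<close> fixes \<open>C = 1 + \<gamma>\<^sup>2\<close>, and \<open>\<alpha>\<close> then adjusts \<open>I = 1 + N \<alpha>\<^sup>2 / (1 + \<gamma>\<^sup>2)\<close> freely.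
\<close>

section \<open>Indexes of a single column\<close>

lemma ones_inner_ones: "(ones :: real^'n) \<bullet> ones = real CARD('n)"
  by (simp add: ones_def inner_vec_def)

lemma inner_ones: "x \<bullet> (ones :: real^'n) = real CARD('n) * mean x"
  by (simp add: ones_def inner_vec_def mean_def)

lemma sum_power2_eq_inner: "(\<Sum>n\<in>UNIV. (x $ n)\<^sup>2) = x \<bullet> (x :: real^'n)"
  by (simp add: inner_vec_def power2_eq_square)

lemma sum_deviations:
  fixes x :: "real^'n"
  shows "(\<Sum>n\<in>UNIV. (x $ n - mean x)\<^sup>2) = (norm (x - mean x *\<^sub>R ones))\<^sup>2"
  using sum_power2_eq_inner[of "x - mean x *\<^sub>R ones"]
  by (simp add: ones_def power2_norm_eq_inner)

text \<open>Bias-variance decomposition, from which everything about one column follows: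
  \<open>c = 0\<close> gives the second moment, and \<open>c = mean x\<close> minimises the
  distance.\<close>

lemma norm_diff_constant:
  fixes x :: "real^'n"
  shows "(norm (x - c *\<^sub>R ones))\<^sup>2 = real CARD('n) * (variance x + (mean x - c)\<^sup>2)"
proof -
  have expand: "(norm (x - d *\<^sub>R ones))\<^sup>2 = x \<bullet> x + real CARD('n) * (d\<^sup>2 - 2 * d * mean x)" for d
    unfolding power2_norm_eq_inner inner_diff_left inner_diff_right
    by (simp add: inner_commute[of ones x] inner_ones[of x] ones_inner_ones power2_eq_square
        algebra_simps)
  have "real CARD('n) * variance x = x \<bullet> x + real CARD('n) * ((mean x)\<^sup>2 - 2 * mean x * mean x)"
    using expand[of "mean x"] by (simp add: variance_def sum_deviations)
  then show ?thesis
    unfolding expand by (simp add: power2_eq_square algebra_simps)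
qed

lemma inner_self: "x \<bullet> x = real CARD('n) * (variance x + (mean x)\<^sup>2)" for x :: "real^'n"
  using norm_diff_constant[of x 0] by (simp add: power2_norm_eq_inner)

lemma variance_nonneg: "variance x \<ge> 0"
  by (simp add: variance_def sum_nonneg)

lemma variance_eq_0_imp_constant:
  assumes "variance x = 0"
  shows "x = mean x *\<^sub>R ones"
  using norm_diff_constant[of x "mean x"] assms by simp

lemma inefficiency_eq:
  assumes "variance x > 0"
  shows "inefficiency x = 1 + (mean x)\<^sup>2 / variance x"
  using assms by (simp add: inefficiency_def sum_power2_eq_inner inner_self field_simps)

lemma inefficiency_ge_1:
  assumes "variance x > 0"
  shows "inefficiency x \<ge> 1"
  using assms by (simp add: inefficiency_eq)

text \<open>The second moment splits into squared mean and variance. \<open>q2 x\<close> is the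
  share of the former, \<open>1 / inefficiency x\<close> that of the latter.\<close>

lemma q2_eq_inefficiency:
  fixes x :: "real^'n"
  assumes "variance x > 0"
  shows "q2 x = 1 - 1 / inefficiency x"
proof -
  have "q2 x = (real CARD('n) * mean x)\<^sup>2
      / (real CARD('n) * (variance x + (mean x)\<^sup>2) * real CARD('n))"
    unfolding q2_def inner_ones[of x] inner_self[of x] ones_inner_ones ..
  also have "\<dots> = (mean x)\<^sup>2 / (variance x + (mean x)\<^sup>2)"
    by (simp add: power2_eq_square)
  also have "\<dots> = 1 - 1 / inefficiency x"
  proof -
    have "variance x + (mean x)\<^sup>2 > 0"
      using assms by (simp add: add_pos_nonneg)
    then show ?thesis
      using assms by (simp add: inefficiency_eq field_simps)
  qed
  finally show ?thesis .
qed

lemma cos_vec_angle_power2: "(cos (vec_angle x ones))\<^sup>2 = q2 x" for x :: "real^'n"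
proof -
  \<comment> \<open>Cauchy-Schwarz puts the quotient in the range where \<open>cos\<close> undoes
    \<open>arccos\<close>; for \<open>x = 0\<close> the quotient is 0 by convention.\<close>
  have "\<bar>x \<bullet> ones\<bar> / (norm x * norm (ones :: real^'n)) \<le> 1"
    by (metis Cauchy_Schwarz_ineq2 div_by_0 divide_le_eq_1 le_less_linear less_eq_real_def
        mult_nonneg_nonneg norm_ge_zero zero_le_one)
  then have "\<bar>(x \<bullet> ones) / (norm x * norm (ones :: real^'n))\<bar> \<le> 1"
    by (simp add: abs_mult)
  then have "cos (vec_angle x ones) = (x \<bullet> ones) / (norm x * norm (ones :: real^'n))"
    unfolding vec_angle_def by (rule cos_arccos_abs)
  then show ?thesis
    by (simp add: q2_def power_divide power_mult_distrib power2_norm_eq_inner)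
qed

lemma mean_scaled: "mean (scaled x) = mean x / std_dev x"
  by (simp add: mean_def scaled_def flip: sum_divide_distrib)

lemma mean_scaled_power2: "(mean (scaled x))\<^sup>2 = (mean x)\<^sup>2 / variance x"
  by (simp add: mean_scaled std_dev_def power_divide variance_nonneg)

text \<open>Every entry of \<open>M_ones\<close> is 1/N, so each row of the matrix averages the
  entries of \<open>x\<close>.\<close>

lemma M_ones_mult: "M_ones *v x = mean x *\<^sub>R (ones :: real^'n)"
  unfolding M_ones_def ones_inner_ones
  by (simp add: vec_eq_iff matrix_vector_mult_def mean_def ones_def divide_inverse
      sum_distrib_left mult.commute)

lemma quadratic_form_M_ones: "x \<bullet> (M_ones *v x) = real CARD('n) * (mean x)\<^sup>2"
  for x :: "real^'n"
  by (simp add: M_ones_mult inner_ones power2_eq_square)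

lemma quadratic_form_mat_1_minus_M_ones:
  "x \<bullet> ((mat 1 - M_ones) *v x) = real CARD('n) * variance x" for x :: "real^'n"
  by (simp add: matrix_vector_mult_diff_rdistrib inner_diff_right quadratic_form_M_ones inner_self
      algebra_simps)

text \<open>By \<open>norm_diff_constant\<close> the nearest multiple of \<open>ones\<close> is
  \<open>mean x *\<^sub>R ones\<close>: it attains the bound, and any other \<open>c\<close> adds a
  nonnegative square.\<close>

lemma infdist_constants:
  fixes x :: "real^'n"
  shows "infdist x (range (\<lambda>c. c *\<^sub>R ones)) = sqrt (real CARD('n) * variance x)"
proof (rule antisym)
  have "dist x (mean x *\<^sub>R ones) = sqrt (real CARD('n) * variance x)"
    using norm_diff_constant[of x "mean x"] by (simp add: dist_norm real_sqrt_unique)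
  then show "infdist x (range (\<lambda>c. c *\<^sub>R ones)) \<le> sqrt (real CARD('n) * variance x)"
    by (metis infdist_le rangeI)
  have "sqrt (real CARD('n) * variance x) \<le> dist x (c *\<^sub>R ones)" for c
    by (rule real_le_lsqrt) (simp_all add: dist_norm norm_diff_constant)
  then show "sqrt (real CARD('n) * variance x) \<le> infdist x (range (\<lambda>c. c *\<^sub>R ones))"
    unfolding infdist_def by (auto intro!: cINF_greatest)
qed

lemma mobility_eq_inefficiency: "mobility x = sqrt (1 / inefficiency x)"
proof -
  have "norm x = sqrt (x \<bullet> x)"
    by (simp add: norm_eq_sqrt_inner)
  then show ?thesis
    by (simp add: mobility_def infdist_constants inefficiency_def sum_power2_eq_inner
        real_sqrt_divide)
qed

text \<open>Reduces divergence to convergence of the reciprocal, which is \<open>1 - q2\<close> and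
  also the square of \<open>mobility\<close>.\<close>

lemma filterlim_inefficiency_at_top_iff:
  assumes "\<And>i. variance (x i) > 0"
  shows "filterlim (\<lambda>i. inefficiency (x i)) at_top F \<longleftrightarrow> ((\<lambda>i. 1 / inefficiency (x i)) \<longlongrightarrow> 0) F"
proof -
  have pos: "inefficiency (x i) > 0" for i
    using inefficiency_ge_1[OF assms] by (meson less_le_trans zero_less_one)
  have "filterlim (\<lambda>i. inverse (1 / inefficiency (x i))) at_top F
      \<longleftrightarrow> ((\<lambda>i. 1 / inefficiency (x i)) \<longlongrightarrow> 0) F"
    by (rule filterlim_inverse_at_top_iff) (simp add: pos)
  then show ?thesis
    by simp
qed

lemma filterlim_inefficiency_at_top_iff_q2:
  assumes "\<And>i. variance (x i) > 0"
  shows "filterlim (\<lambda>i. inefficiency (x i)) at_top F \<longleftrightarrow> ((\<lambda>i. q2 (x i)) \<longlongrightarrow> 1) F"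
proof -
  have "((\<lambda>i. q2 (x i)) \<longlongrightarrow> 1) F \<longleftrightarrow> ((\<lambda>i. 1 - q2 (x i)) \<longlongrightarrow> 0) F"
    using tendsto_diff[OF tendsto_const[of "1 :: real"], of "\<lambda>i. q2 (x i)" 1 F]
      tendsto_diff[OF tendsto_const[of "1 :: real"], of "\<lambda>i. 1 - q2 (x i)" 0 F]
    by auto
  also have "(\<lambda>i. 1 - q2 (x i)) = (\<lambda>i. 1 / inefficiency (x i))"
    using assms by (simp add: q2_eq_inefficiency)
  finally show ?thesis
    using assms by (simp add: filterlim_inefficiency_at_top_iff)
qed

lemma filterlim_inefficiency_at_top_iff_mobility:
  assumes "\<And>i. variance (x i) > 0"
  shows "filterlim (\<lambda>i. inefficiency (x i)) at_top F \<longleftrightarrow> ((\<lambda>i. mobility (x i)) \<longlongrightarrow> 0) F"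
proof -
  have "1 / inefficiency (x i) = (mobility (x i))\<^sup>2" for i
    using inefficiency_ge_1[OF assms, of i] by (simp add: mobility_eq_inefficiency)
  then have "((\<lambda>i. 1 / inefficiency (x i)) \<longlongrightarrow> 0) F"
    if "((\<lambda>i. mobility (x i)) \<longlongrightarrow> 0) F"
    using tendsto_power[OF that, of 2] by simp
  moreover have "((\<lambda>i. mobility (x i)) \<longlongrightarrow> 0) F"
    if "((\<lambda>i. 1 / inefficiency (x i)) \<longlongrightarrow> 0) F"
    using tendsto_real_sqrt[OF that] by (simp add: mobility_eq_inefficiency)
  ultimately show ?thesis
    using assms by (auto simp: filterlim_inefficiency_at_top_iff)
qed

section \<open>Columns of a design matrix\<close>

text \<open>A combination of the other columns is \<open>X *v z\<close> with
  \<open>z $ k = 0\<close>. If it equalled column \<open>k\<close>, injectivity of \<open>X\<close>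
  would force \<open>z\<close> to be the unit vector \<open>axis k 1\<close>.\<close>

lemma column_notin_span_other_columns:
  fixes X :: "real^'k^'n"
  assumes "rank X = CARD('k)"
  shows "column k X \<notin> span {column j X | j. j \<noteq> k}"
proof
  assume "column k X \<in> span {column j X | j. j \<noteq> k}"
  moreover have "subspace ((*v) X ` {z. z $ k = 0})"
    by (rule linear_subspace_image) (auto simp: subspace_def)
  moreover have "{column j X | j. j \<noteq> k} \<subseteq> (*v) X ` {z. z $ k = 0}"
    by (force simp: image_iff axis_def intro: matrix_vector_mult_basis[symmetric])
  ultimately obtain z where z: "z $ k = 0" "column k X = X *v z"
    using span_minimal by blast
  then have "X *v axis k 1 = X *v z"
    by (simp add: matrix_vector_mult_basis)
  then have "axis k 1 = z"
    using assms by (simp add: full_rank_injective inj_eq)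
  with z show False
    by auto
qed

text \<open>Zero variance would make column \<open>k\<close> a multiple of \<open>ones\<close>,
  which is one of the other columns.\<close>

lemma variance_column_pos:
  assumes "X \<in> design_matrices k1" "k \<noteq> k1"
  shows "variance (column k X) > 0"
proof (rule ccontr)
  assume "\<not> variance (column k X) > 0"
  then have "variance (column k X) = 0"
    using variance_nonneg[of "column k X"] by linarith
  then have "column k X = mean (column k X) *\<^sub>R column k1 X"
    using variance_eq_0_imp_constant assms(1) by (auto simp: design_matrices_def)
  moreover have "mean (column k X) *\<^sub>R column k1 X \<in> span {column j X | j. j \<noteq> k}"
    using assms(2) by (intro span_mul span_base) auto
  ultimately show False
    using column_notin_span_other_columns[of X k] assms(1) by (auto simp: design_matrices_def)
qed

section \<open>Least squares fits and the variance inflation factor\<close>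

lemma r_squared_eq:
  fixes y :: "real^'n"
  shows "r_squared S y
    = 1 - (norm (y - ols_fit S y))\<^sup>2 / (real CARD('n) * variance y)"
proof -
  have "(\<Sum>n\<in>UNIV. (y $ n - ols_fit S y $ n)\<^sup>2) = (norm (y - ols_fit S y))\<^sup>2"
    using sum_power2_eq_inner[of "y - ols_fit S y"] by (simp add: power2_norm_eq_inner)
  moreover have "(\<Sum>n\<in>UNIV. (y $ n - mean y)\<^sup>2) = real CARD('n) * variance y"
    by (simp add: variance_def)
  ultimately show ?thesis
    unfolding r_squared_def by simp
qed

text \<open>The normal equations characterise the fit: if the residual is orthogonal to the
  regressors, Pythagoras makes \<open>p\<close> the nearest point of the span.\<close>

lemma ols_fit_eqI:
  assumes "p \<in> span S" and "\<And>s. s \<in> S \<Longrightarrow> orthogonal (y - p) s"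
  shows "ols_fit S y = p"
  unfolding ols_fit_def
proof (rule closest_point_unique[symmetric])
  show "\<forall>z\<in>span S. dist y p \<le> dist y z"
  proof
    fix z assume "z \<in> span S"
    then have "p - z \<in> span S"
      using assms(1) by (intro span_diff)
    then have "orthogonal (y - p) (p - z)"
      using assms(2) by (rule orthogonal_to_span)
    then have "(norm ((y - p) + (p - z)))\<^sup>2 = (norm (y - p))\<^sup>2 + (norm (p - z))\<^sup>2"
      by (rule norm_add_Pythagorean)
    then have "(norm (y - p))\<^sup>2 \<le> (norm (y - z))\<^sup>2"
      by simp
    then show "dist y p \<le> dist y z"
      unfolding dist_norm by (rule power2_le_imp_le) simp
  qed
qed (use assms(1) in \<open>simp_all add: subspace_imp_convex subspace_span closed_span\<close>)

lemma VIF_eq: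
  fixes X :: "real^'k^'n"
  assumes "CARD('k) \<noteq> 2"
  shows "VIF X k = real CARD('n) * variance (column k X)
    / (norm (column k X - ols_fit {column j X | j. j \<noteq> k} (column k X)))\<^sup>2"
  using assms by (simp add: VIF_def R2_check_def r_squared_eq)

lemma VIF_eq_card_2:
  fixes X :: "real^'k^'n"
  assumes "CARD('k) = 2"
  shows "VIF X k = 1 / (1 - q2 (column k X))"
  using assms by (simp add: VIF_def R2_check_def q2_def)

text \<open>Here \<open>VIF\<close> is TSS/RSS. The multiple of \<open>ones\<close> by the mean
  competes in the least squares problem, so RSS is at most TSS; full rank makes RSS nonzero, which
  excludes the default value of division by zero.\<close>

lemma VIF_ge_1:
  fixes X :: "real^'k^'n"
  assumes "CARD('k) \<noteq> 2" "X \<in> design_matrices k1" "k \<noteq> k1"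
  shows "VIF X k \<ge> 1"
proof -
  define y where "y = column k X"
  define S where "S = {column j X | j. j \<noteq> k}"
  have "ols_fit S y \<in> span S"
    unfolding ols_fit_def by (rule closest_point_in_set) (use span_zero in \<open>auto simp: closed_span\<close>)
  then have "y \<noteq> ols_fit S y"
    using column_notin_span_other_columns[of X k] assms(2)
    by (auto simp: y_def S_def design_matrices_def)
  moreover have "mean y *\<^sub>R ones \<in> span S"
    using assms(2,3) by (intro span_mul span_base) (force simp: S_def design_matrices_def)
  then have "dist y (ols_fit S y) \<le> dist y (mean y *\<^sub>R ones)"
    unfolding ols_fit_def by (intro closest_point_le) (auto simp: closed_span)
  then have "(norm (y - ols_fit S y))\<^sup>2 \<le> (norm (y - mean y *\<^sub>R ones))\<^sup>2"
    by (simp add: dist_norm power_mono)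
  ultimately show ?thesis
    using assms(1) by (simp add: VIF_eq norm_diff_constant flip: y_def S_def)
qed

section \<open>Design matrices with prescribed indexes\<close>

text \<open>The normalised \<open>ones\<close> extends to an orthonormal basis of N vectors, from
  which K are selected.\<close>

lemma orthonormal_family_with_ones:
  fixes k1 :: "'k::finite"
  assumes "CARD('n::finite) \<ge> CARD('k)"
  obtains b :: "'k \<Rightarrow> real^'n"
  where "\<And>i j. b i \<bullet> b j = (if i = j then 1 else 0)" "ones = sqrt (real CARD('n)) *\<^sub>R b k1"
proof -
  define a :: "real^'n" where "a = ones /\<^sub>R sqrt (real CARD('n))"
  have norm_ones: "norm (ones :: real^'n) = sqrt (real CARD('n))"
    by (simp add: norm_eq_sqrt_inner ones_inner_ones)
  then have "norm a = 1"
    by (simp add: a_def)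
  then obtain S where S: "a \<in> S" "pairwise orthogonal S" "\<And>x. x \<in> S \<Longrightarrow> norm x = 1"
    "independent S" "card S = DIM(real^'n)"
    using vector_in_orthonormal_basis by metis
  have "finite S"
    using S(4) by (simp add: finiteI_independent)
  then have "card (UNIV - {k1}) \<le> card (S - {a})"
    using S(1,5) assms by (simp add: card_Diff_singleton)
  then obtain f where f: "f ` (UNIV - {k1}) \<subseteq> S - {a}" "inj_on f (UNIV - {k1})"
    using card_le_inj[of "UNIV - {k1}" "S - {a}"] \<open>finite S\<close> by auto
  define b where "b = f(k1 := a)"
  have bS: "b i \<in> S" for i
    using f(1) S(1) by (auto simp: b_def)
  have "b i \<noteq> b j" if "i \<noteq> j" for i j
    using that f by (auto simp: b_def inj_on_def)
  then have "b i \<bullet> b j = (if i = j then 1 else 0)" for i j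
    using S(2) S(3)[OF bS] bS by (auto simp: pairwise_def orthogonal_def norm_eq_1)
  moreover have "ones = sqrt (real CARD('n)) *\<^sub>R b k1"
    by (simp add: b_def a_def)
  ultimately show ?thesis
    by (rule that)
qed

text \<open>For \<open>K = 2\<close> there is no index \<open>k2\<close> different from both \<open>k1\<close> and \<open>k\<close>, so \<open>\<gamma> = 0\<close> is forced.\<close>

lemma design_matrix_with_parameters:
  fixes k k1 k2 :: "'k::finite" and \<alpha> \<gamma> :: real
  assumes card: "CARD('n::finite) \<ge> CARD('k)" and "k \<noteq> k1" "k2 \<noteq> k" "k2 = k1 \<Longrightarrow> \<gamma> = 0"
  obtains X :: "real^'k^'n"
  where "X \<in> design_matrices k1"
    and "inefficiency (column k X) = 1 + real CARD('n) * \<alpha>\<^sup>2 / (1 + \<gamma>\<^sup>2)"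
    and "CARD('k) \<noteq> 2 \<Longrightarrow> VIF X k = 1 + \<gamma>\<^sup>2"
proof -
  define r where "r = sqrt (real CARD('n))"
  have r: "r\<^sup>2 = real CARD('n)" "r > 0"
    by (simp_all add: r_def)
  obtain b :: "'k \<Rightarrow> real^'n" where b: "\<And>i j. b i \<bullet> b j = (if i = j then 1 else 0)"
    and ones: "ones = r *\<^sub>R b k1"
    using orthonormal_family_with_ones[OF card] unfolding r_def by metis
  \<comment> \<open>\<open>p\<close> is designed to be the fitted value of column \<open>k\<close>,
    with residual \<open>b k\<close>.\<close>
  define p where "p = \<alpha> *\<^sub>R ones + \<gamma> *\<^sub>R b k2"
  define w where "w j = (if j = k then p + b k else if j = k1 then ones else b j)" for j
  define X :: "real^'k^'n" where "X = (\<chi> n j. w j $ n)"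
  have col: "column j X = w j" for j
    by (simp add: X_def column_def)
  have p_k: "p \<bullet> b k = 0"
    using assms by (simp add: p_def ones b inner_add_left)
  have w_k: "w j \<bullet> b k = (if j = k then 1 else 0)" for j
    using assms p_k by (simp add: w_def b inner_add_left ones)
  \<comment> \<open>Only column \<open>k\<close> has a component along \<open>b k\<close>, so
    pairing with \<open>b k\<close> isolates \<open>z $ k\<close>. Once that vanishes, pairing with
    \<open>b i\<close> isolates \<open>z $ i\<close>, with factor \<open>r\<close> at
    \<open>k1\<close>.\<close>
  have "z = 0" if "X *v z = 0" for z
  proof -
    have lin: "(\<Sum>j\<in>UNIV. z $ j *\<^sub>R w j) = 0"
      using that by (simp add: matrix_mult_sum col scalar_mult_eq_scaleR)
    have "(\<Sum>j\<in>UNIV. z $ j *\<^sub>R w j) \<bullet> b k = z $ k"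
      by (simp add: inner_sum_left w_k if_distrib sum.delta cong: if_cong)
    with lin have zk: "z $ k = 0"
      by simp
    have "z $ i = 0" if "i \<noteq> k" for i
    proof -
      have "(z $ j *\<^sub>R w j) \<bullet> b i = (if j = i then z $ i * (if i = k1 then r else 1) else 0)" for j
        using that zk by (auto simp: w_def b ones)
      then have "(\<Sum>j\<in>UNIV. z $ j *\<^sub>R w j) \<bullet> b i = z $ i * (if i = k1 then r else 1)"
        unfolding inner_sum_left by (simp add: sum.delta)
      with lin show ?thesis
        using r(2) by (auto split: if_splits)
    qed
    with zk show ?thesis
      by (metis vec_eq_iff zero_index)
  qed
  then have "inj ((*v) X)"
    by (simp add: linear_injective_0[OF matrix_vector_mul_linear])
  then have "rank X = CARD('k)"
    by (simp add: full_rank_injective)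
  then have D: "X \<in> design_matrices k1"
    using assms(2) by (simp add: design_matrices_def col w_def)
  have ck: "column k X = \<alpha> *\<^sub>R ones + \<gamma> *\<^sub>R b k2 + b k"
    by (simp add: col w_def p_def)
  \<comment> \<open>Pairing with \<open>ones\<close> kills \<open>b k\<close>, and also the \<gamma>
    term: either \<open>b k2\<close> is orthogonal to \<open>ones\<close> or \<gamma> is 0.\<close>
  have "real CARD('n) * mean (column k X) = real CARD('n) * \<alpha>"
    using assms(2-4) r
    by (auto simp: ck b ones inner_add_left power2_eq_square simp flip: inner_ones)
  then have mean: "mean (column k X) = \<alpha>"
    by simp
  have "real CARD('n) * variance (column k X) = (norm (\<gamma> *\<^sub>R b k2 + b k))\<^sup>2"
    using norm_diff_constant[of "column k X" \<alpha>] by (simp add: mean) (simp add: ck)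
  also have "\<dots> = 1 + \<gamma>\<^sup>2"
    using assms(3) unfolding power2_norm_eq_inner
    by (simp add: inner_add_left inner_add_right b power2_eq_square)
  finally have var: "real CARD('n) * variance (column k X) = 1 + \<gamma>\<^sup>2" .
  then have "variance (column k X) = (1 + \<gamma>\<^sup>2) / real CARD('n)"
    by (simp add: field_simps)
  then have ineff: "inefficiency (column k X) = 1 + real CARD('n) * \<alpha>\<^sup>2 / (1 + \<gamma>\<^sup>2)"
    using variance_column_pos[OF D assms(2)] by (simp add: inefficiency_eq mean)
  define S where "S = {column j X | j. j \<noteq> k}"
  have in_S: "w j \<in> S" if "j \<noteq> k" for j
    using that by (auto simp: S_def col)
  have "ols_fit S (column k X) = p"
  proof (rule ols_fit_eqI)
    have "ones \<in> S"
      using in_S[of k1] assms(2) by (simp add: w_def)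
    moreover have "\<gamma> *\<^sub>R b k2 \<in> span S"
    proof (cases "k2 = k1")
      case False
      then have "b k2 \<in> S"
        using in_S[of k2] assms(3) by (simp add: w_def)
      then show ?thesis
        by (intro span_mul span_base)
    qed (simp add: assms(4) span_zero)
    ultimately show "p \<in> span S"
      unfolding p_def by (simp add: span_add span_mul span_base)
    fix s assume "s \<in> S"
    then obtain j where "j \<noteq> k" "s = w j"
      by (auto simp: S_def col)
    moreover have "column k X - p = b k"
      by (simp add: col w_def)
    ultimately show "orthogonal (column k X - p) s"
      using w_k[of j] by (simp add: orthogonal_def inner_commute)
  qed
  then have "norm (column k X - ols_fit S (column k X)) = 1"
    by (simp add: col w_def norm_eq_1 b)
  then have "VIF X k = 1 + \<gamma>\<^sup>2" if "CARD('k) \<noteq> 2"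
    using that by (simp add: VIF_eq var flip: S_def)
  with D ineff show ?thesis
    by (rule that)
qed

lemma index_pair_surjective:
  fixes k k1 :: "'k::finite"
  assumes "CARD('n::finite) \<ge> CARD('k)" "CARD('k) \<ge> 3" "k \<noteq> k1" "s \<ge> 1" "t \<ge> 1"
  obtains X :: "real^'k^'n"
  where "X \<in> design_matrices k1" "inefficiency (column k X) = s" "VIF X k = t"
proof -
  \<comment> \<open>This is where K at least 3 enters: a third column is needed to vary the
    collinearity separately.\<close>
  have "{k, k1} \<noteq> UNIV"
    using assms(2,3) card_2_iff[of "UNIV :: 'k set"] by auto
  then obtain k2 where k2: "k2 \<noteq> k" "k2 \<noteq> k1"
    by auto
  \<comment> \<open>These values solve 1 + \<gamma>^2 = t and then 1 + N \<alpha>^2 / t = s.\<close>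
  define \<gamma> where "\<gamma> = sqrt (t - 1)"
  define \<alpha> where "\<alpha> = sqrt ((s - 1) * t / real CARD('n))"
  have "\<gamma>\<^sup>2 = t - 1" "\<alpha>\<^sup>2 = (s - 1) * t / real CARD('n)"
    using assms(4,5) by (simp_all add: \<gamma>_def \<alpha>_def)
  moreover obtain X :: "real^'k^'n" where "X \<in> design_matrices k1"
    "inefficiency (column k X) = 1 + real CARD('n) * \<alpha>\<^sup>2 / (1 + \<gamma>\<^sup>2)" "VIF X k = 1 + \<gamma>\<^sup>2"
    using design_matrix_with_parameters[OF assms(1,3) k2(1), of \<gamma> \<alpha>] k2(2) assms(2) by force
  ultimately show ?thesis
    using that assms(5) by simp
qed

text \<open>Being a measure of collinearity or immobility is rendered by agreement of strict order
  and of the limiting extreme with the squared cosine or, reversed, with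
  \<open>mobility\<close>.\<close>

theorem proposition2p2:
  fixes X :: "real^'k^'n" and k1 k :: 'k
  assumes "CARD('n) > CARD('k)" and "CARD('k) \<ge> 2"
    and "X \<in> design_matrices k1" and "k \<noteq> k1"
  shows
    "let D = (design_matrices k1 :: (real^'k^'n) set);
         x = column k X;
         I = (\<lambda>Y :: real^'k^'n. inefficiency (column k Y));
         C = (\<lambda>Y :: real^'k^'n. VIF Y k);
         H = (\<lambda>Y :: real^'k^'n. H_index Y k);
         q = (\<lambda>Y :: real^'k^'n. q2 (column k Y));
         m = (\<lambda>Y :: real^'k^'n. mobility (column k Y))
     in
      (CARD('k) \<ge> 3 \<longrightarrow>
         separable_on D I C \<and> I ` D = {1..} \<and> C ` D = {1..} \<and>
         0 < variance x \<and>
         I X = 1 + (mean (scaled x))\<^sup>2 \<and>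
         1 + (mean (scaled x))\<^sup>2 = 1 + (mean x)\<^sup>2 / variance x \<and>
         1 + (mean x)\<^sup>2 / variance x
           = 1 + (x \<bullet> (M_ones *v x)) / (x \<bullet> ((mat 1 - M_ones) *v x)) \<and>
         1 + (x \<bullet> (M_ones *v x)) / (x \<bullet> ((mat 1 - M_ones) *v x)) = 1 + q X / (1 - q X) \<and>
         1 + q X / (1 - q X) = 1 / (1 - q X) \<and>
         q X \<in> {0..<1} \<and>
         strict_mono_on {0..<1} (\<lambda>t::real. 1 / (1 - t)) \<and>
         q X = (cos (vec_angle x ones))\<^sup>2)
      \<and>
      (CARD('k) = 2 \<longrightarrow>
         I X = 1 / (1 - q X) \<and>
         C X = 1 / (1 - q X) \<and>
         H X = 1 / (1 - q X)\<^sup>2 \<and>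
         \<not> separable_on D I C \<and>
         (H X = 1 \<longleftrightarrow> x \<bullet> ones = 0))
      \<and>
      (I X = 1 / (1 - q X) \<and>
       \<comment> \<open>collinearity of \<open>e\<close> and \<open>x\<^sub>k\<close>\<close>
       (I X = 1 \<longleftrightarrow> orthogonal x ones) \<and>
       (\<forall>Y\<in>D. \<forall>Z\<in>D. I Y < I Z \<longleftrightarrow>
          (cos (vec_angle (column k Y) ones))\<^sup>2 < (cos (vec_angle (column k Z) ones))\<^sup>2) \<and>
       (\<forall>Y. (\<forall>i::nat. Y i \<in> D) \<longrightarrow>
          (filterlim (\<lambda>i. I (Y i)) at_top sequentially \<longleftrightarrow>
           (\<lambda>i. (cos (vec_angle (column k (Y i)) ones))\<^sup>2) \<longlonglongrightarrow> 1)) \<and>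
       \<comment> \<open>immobility of \<open>x\<^sub>k\<close>\<close>
       (\<forall>Y\<in>D. \<forall>Z\<in>D. I Y < I Z \<longleftrightarrow> m Z < m Y) \<and>
       (\<forall>Y. (\<forall>i::nat. Y i \<in> D) \<longrightarrow>
          (filterlim (\<lambda>i. I (Y i)) at_top sequentially \<longleftrightarrow> (\<lambda>i. m (Y i)) \<longlonglongrightarrow> 0)))"
proof -
  define D where "D = (design_matrices k1 :: (real^'k^'n) set)"
  define I where "I Y = inefficiency (column k Y)" for Y :: "real^'k^'n"
  define C where "C Y = VIF Y k" for Y :: "real^'k^'n"
  define q where "q Y = q2 (column k Y)" for Y :: "real^'k^'n"
  define m where "m Y = mobility (column k Y)" for Y :: "real^'k^'n"
  define x where "x = column k X"
  have card: "CARD('n) \<ge> CARD('k)"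
    using assms(1) by simp
  have var: "variance (column k Y) > 0" if "Y \<in> D" for Y
    using that assms(4) variance_column_pos unfolding D_def by blast
  have I_ge: "I Y \<ge> 1" if "Y \<in> D" for Y
    using inefficiency_ge_1[OF var[OF that]] by (simp add: I_def)
  have q: "q Y = 1 - 1 / I Y" if "Y \<in> D" for Y
    using q2_eq_inefficiency[OF var[OF that]] by (simp add: I_def q_def)
  have I: "I Y = 1 / (1 - q Y)" if "Y \<in> D" for Y
    using q[OF that] by simp
  have X: "X \<in> D"
    using assms(3) by (simp add: D_def)
  have varx: "variance x > 0"
    using var[OF X] by (simp add: x_def)
  have q_range: "q X \<in> {0..<1}"
    using q[OF X] I_ge[OF X] by simp
  have I_1: "I X = 1 \<longleftrightarrow> x \<bullet> ones = 0"
    using varx inefficiency_eq[OF varx] by (simp add: I_def inner_ones flip: x_def)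

  have part1: "separable_on D I C \<and> I ` D = {1..} \<and> C ` D = {1..}" if K: "CARD('k) \<ge> 3"
  proof -
    \<comment> \<open>All pairs of values from 1 upwards are attained and both indexes are bounded
      below by 1, so the joint image is a full product.\<close>
    have "\<exists>Y\<in>D. I Y = s \<and> C Y = t" if "s \<ge> 1" "t \<ge> 1" for s t
      using index_pair_surjective[OF card K assms(4) that] unfolding D_def I_def C_def by metis
    moreover have "C Y \<ge> 1" if "Y \<in> D" for Y
      using VIF_ge_1[of Y k1 k] that K assms(4) by (simp add: C_def D_def)
    ultimately have "(\<lambda>Y. (I Y, C Y)) ` D = {1..} \<times> {1..}" "I ` D = {1..}" "C ` D = {1..}"
      using I_ge by (force simp: image_iff)+
    then show ?thesis
      by (simp add: separable_on_def)
  qed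

  have chain: "I X = 1 + (mean (scaled x))\<^sup>2"
      "1 + (mean (scaled x))\<^sup>2 = 1 + (mean x)\<^sup>2 / variance x"
      "1 + (mean x)\<^sup>2 / variance x
        = 1 + (x \<bullet> (M_ones *v x)) / (x \<bullet> ((mat 1 - M_ones) *v x))"
      "1 + (x \<bullet> (M_ones *v x)) / (x \<bullet> ((mat 1 - M_ones) *v x)) = 1 + q X / (1 - q X)"
      "1 + q X / (1 - q X) = 1 / (1 - q X)"
  proof -
    have I_mean: "I X = 1 + (mean x)\<^sup>2 / variance x"
      using inefficiency_eq[OF varx] by (simp add: I_def flip: x_def)
    then show "I X = 1 + (mean (scaled x))\<^sup>2"
      by (simp add: mean_scaled_power2)
    show "1 + (mean (scaled x))\<^sup>2 = 1 + (mean x)\<^sup>2 / variance x"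
      by (simp add: mean_scaled_power2)
    show M: "1 + (mean x)\<^sup>2 / variance x
        = 1 + (x \<bullet> (M_ones *v x)) / (x \<bullet> ((mat 1 - M_ones) *v x))"
      by (simp add: quadratic_form_M_ones quadratic_form_mat_1_minus_M_ones)
    show q_frac: "1 + q X / (1 - q X) = 1 / (1 - q X)"
      using q_range by (simp add: field_simps)
    show "1 + (x \<bullet> (M_ones *v x)) / (x \<bullet> ((mat 1 - M_ones) *v x)) = 1 + q X / (1 - q X)"
      using I_mean M q_frac I[OF X] by simp
  qed

  have mono: "strict_mono_on {0..<1} (\<lambda>t::real. 1 / (1 - t))"
    by (auto simp: strict_mono_on_def intro!: divide_strict_left_mono mult_pos_pos)

  have part2: "C X = 1 / (1 - q X) \<and> H_index X k = 1 / (1 - q X)\<^sup>2 \<and>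
      \<not> separable_on D I C \<and> (H_index X k = 1 \<longleftrightarrow> x \<bullet> ones = 0)" if K: "CARD('k) = 2"
  proof -
    \<comment> \<open>For two columns the joint image lies on the diagonal, so one nonconstant index
      already rules out a product.\<close>
    have CI: "C Y = I Y" if "Y \<in> D" for Y
      using I[OF that] by (simp add: C_def VIF_eq_card_2[OF K] flip: q_def)
    have H: "H_index X k = (I X)\<^sup>2"
      using CI[OF X] by (simp add: H_index_def I_def C_def power2_eq_square)
    \<comment> \<open>With \<open>k2 = k1\<close> and \<gamma> = 0, the choices \<alpha> = 0 and
      \<alpha> = 1 give two distinct values of \<open>I\<close>.\<close>
    have "\<exists>Y\<in>D. I Y = 1 + real CARD('n) * \<alpha>\<^sup>2" for \<alpha>
      using design_matrix_with_parameters[OF card assms(4), of k1 0 \<alpha>] assms(4)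
      unfolding D_def I_def by (metis add_0_right div_by_1 zero_power2)
    from this[of 0] this[of 1] obtain Y Z
      where YZ: "Y \<in> D" "Z \<in> D" "I Y = 1" "I Z = 1 + real CARD('n)"
      by auto
    have "\<not> separable_on D I C"
    proof
      assume "separable_on D I C"
      then have "(I Y, C Z) \<in> (\<lambda>X. (I X, C X)) ` D"
        using YZ by (simp add: separable_on_def)
      then have "I Y = C Z"
        using CI by auto
      with YZ CI[OF YZ(2)] show False
        by simp
    qed
    \<comment> \<open>The bound \<open>I X \<ge> 1\<close> excludes the root -1.\<close>
    moreover have "(I X)\<^sup>2 = 1 \<longleftrightarrow> I X = 1"
      using I_ge[OF X] by (auto simp: power2_eq_1_iff)
    ultimately show ?thesis
      using CI[OF X] I[OF X] H I_1 by (simp add: power_divide)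
  qed

  have order_q: "I Y < I Z \<longleftrightarrow> q Y < q Z" and order_m: "I Y < I Z \<longleftrightarrow> m Z < m Y"
    if "Y \<in> D" "Z \<in> D" for Y Z
  proof -
    \<comment> \<open>Both orderings come from the reciprocal: \<open>q\<close> is 1 minus it, and
      \<open>m\<close> is its square root.\<close>
    have inv: "1 / I Z < 1 / I Y \<longleftrightarrow> I Y < I Z"
      using I_ge[OF that(1)] I_ge[OF that(2)] by (auto simp: field_simps)
    then show "I Y < I Z \<longleftrightarrow> q Y < q Z"
      using q that by auto
    show "I Y < I Z \<longleftrightarrow> m Z < m Y"
      using inv by (simp add: m_def mobility_eq_inefficiency flip: I_def)
  qed
  have limit_q: "filterlim (\<lambda>i. I (Y i)) at_top sequentially \<longleftrightarrow> (\<lambda>i. q (Y i)) \<longlonglongrightarrow> 1"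
    and limit_m: "filterlim (\<lambda>i. I (Y i)) at_top sequentially \<longleftrightarrow> (\<lambda>i. m (Y i)) \<longlonglongrightarrow> 0"
    if "\<forall>i::nat. Y i \<in> D" for Y
    using that var filterlim_inefficiency_at_top_iff_q2[of "\<lambda>i. column k (Y i)"]
      filterlim_inefficiency_at_top_iff_mobility[of "\<lambda>i. column k (Y i)"]
    by (simp_all add: I_def q_def m_def)

  \<comment> \<open>Rewriting squared cosines to \<open>q2\<close> turns the angle claims into
    \<open>order_q\<close> and \<open>limit_q\<close>.\<close>
  show ?thesis
    unfolding Let_def cos_vec_angle_power2 orthogonal_def
      D_def[symmetric] x_def[symmetric] I_def[symmetric, abs_def] C_def[symmetric, abs_def]
    using part1 part2 varx chain q_range mono I[OF X] I_1 order_q order_m limit_q limit_m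
    unfolding q_def m_def x_def by auto
qed

end
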